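(* Let $\mathcal{A}$ be a real symmetric tensor of even order $m$ and dimension $n$ that is a positive semi-definite extended $Z$-tensor. Then $\mathcal{A}$ has an SOS tensor decomposition.
   Context: A real tensor of order $m$ and dimension $n$ is an array $\mathcal{A}=(a_{i_1\cdots i_m})$ with $i_1,\dots,i_m\in[n]=\{1,\dots,n\}$; it is symmetric if its entries are invariant under permutations of the indices. Its associated form is $f_{\mathcal{A}}(\mathbf{x})=\mathcal{A}\mathbf{x}^m=\sum_{i_1,\dots,i_m\in[n]}a_{i_1\cdots i_m}x_{i_1}\cdots x_{i_m}$. $\mathcal{A}$ is positive semi-definite if $f_{\mathcal{A}}(\mathbf{x})\ge0$ for all $\mathbf{x}\in\mathbb{R}^n$. For even $m$, $\mathcal{A}$ has an SOS tensor decomposition if $f_{\mathcal{A}}$ is a finite sum of squares of real polynomials. A polynomial $f$ of degree $m$ on $\mathbb{R}^n$ is an extended $Z$-polynomial if there exist $s\in\mathbb{N}$, $s\le n$, and index sets $\Gamma_1,\dots,\Gamma_s\subseteq[n]$ with $\bigcup_{l=1}^s\Gamma_l=[n]$ and $\Gamma_{l_1}\cap\Gamma_{l_2}=\emptyset$ for $l_1\ne l_2$, such that $f(\mathbf{x})=\sum_{i=1}^n f_{m,i}x_i^m+\sum_{l=1}^s\sum_{\alpha_l\in\Omega_l}f_{\alpha_l}\mathbf{x}^{\alpha_l}$, where $f_{m,i}$ is the coefficient of $x_i^m$ in $f$, $\Omega_l$ is the set of $\alpha\in(\mathbb{N}\cup\{0\})^n$ with $|\alpha|=m$, $\mathbf{x}^\alpha=x_{i_1}\cdots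 x_{i_m}$ with $\{i_1,\dots,i_m\}\subseteq\Gamma_l$, and $\alpha\ne m\,\mathbf{e}_i$ for all $i$ ($\mathbf{e}_i$ the $i$th unit vector), and for each $l=1,\dots,s$ one of the following holds: (1) $f_{\alpha_l}=0$ for all but one $\alpha_l\in\Omega_l$; (2) $f_{\alpha_l}\le0$ for all $\alpha_l\in\Omega_l$. A symmetric tensor $\mathcal{A}$ is an extended $Z$-tensor if $f_{\mathcal{A}}$ is an extended $Z$-polynomial. *)

theory Defs
  imports "HOL-Analysis.Analysis" "HOL-Library.Poly_Mapping" "HOL-Combinatorics.Permutations"
begin

text \<open>Variables are indexed by a finite type \<open>'n\<close>, so the dimension is \<open>n = CARD('n)\<close> and
  \<open>[n]\<close> is \<open>UNIV :: 'n set\<close>. A multi-index is an element of \<open>'n \<Rightarrow>\<^sub>0 nat\<close>; the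
  (convolution) ring \<open>('n \<Rightarrow>\<^sub>0 nat) \<Rightarrow>\<^sub>0 real\<close> is the polynomial ring over the reals in these
  variables, and \<open>lookup f \<alpha>\<close> is the coefficient of the monomial \<open>x\<^sup>\<alpha>\<close> in \<open>f\<close>.\<close>

type_synonym 'n real_mpoly = "('n \<Rightarrow>\<^sub>0 nat) \<Rightarrow>\<^sub>0 real"

definition mpoly_eval :: "'n::finite real_mpoly \<Rightarrow> real ^ 'n \<Rightarrow> real" where
  "mpoly_eval f x = (\<Sum>\<alpha>\<in>Poly_Mapping.keys f. Poly_Mapping.lookup f \<alpha> * (\<Prod>i\<in>UNIV. (x $ i) ^ Poly_Mapping.lookup \<alpha> i))"

text \<open>A tensor of order \<open>m\<close> is a function on index lists, of which only the values on lists of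
  length \<open>m\<close> matter.\<close>

type_synonym 'n tensor = "'n list \<Rightarrow> real"

definition symmetric_tensor :: "nat \<Rightarrow> 'n::finite tensor \<Rightarrow> bool" where
  "symmetric_tensor m A \<longleftrightarrow>
     (\<forall>is \<sigma>. length is = m \<longrightarrow> \<sigma> permutes {..<m} \<longrightarrow> A (permute_list \<sigma> is) = A is)"

text \<open>The form \<open>f\<^sub>A\<close> as a formal polynomial; the multi-index \<open>\<Sum>i\<leftarrow>is. single i 1\<close> is that of
  the monomial \<open>\<Prod>i\<leftarrow>is. x\<^sub>i\<close>.\<close>

definition tensor_form :: "nat \<Rightarrow> 'n::finite tensor \<Rightarrow> 'n real_mpoly" where
  "tensor_form m A =
     (\<Sum>is | length is = m. Poly_Mapping.single (\<Sum>i\<leftarrow>is. Poly_Mapping.single i 1) (A is))"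

definition psd_tensor :: "nat \<Rightarrow> 'n::finite tensor \<Rightarrow> bool" where
  "psd_tensor m A \<longleftrightarrow> (\<forall>x :: real ^ 'n. 0 \<le> mpoly_eval (tensor_form m A) x)"

definition sos_tensor_decomposition :: "nat \<Rightarrow> 'n::finite tensor \<Rightarrow> bool" where
  "sos_tensor_decomposition m A \<longleftrightarrow>
     (\<exists>gs :: 'n real_mpoly list. tensor_form m A = (\<Sum>g\<leftarrow>gs. g ^ 2))"

text \<open>The set \<open>\<Omega>\<^sub>l\<close> belonging to \<open>\<Gamma>\<^sub>l = G\<close>: the multi-indices of weight \<open>m\<close> supported in \<open>G\<close>,
  other than the multi-indices \<open>single i m\<close> of the pure powers.\<close>

definition mixed_indices :: "nat \<Rightarrow> 'n::finite set \<Rightarrow> ('n \<Rightarrow>\<^sub>0 nat) set" where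
  "mixed_indices m G =
     {\<alpha>. (\<Sum>i\<in>UNIV. Poly_Mapping.lookup \<alpha> i) = m \<and> Poly_Mapping.keys \<alpha> \<subseteq> G \<and> (\<forall>i. \<alpha> \<noteq> Poly_Mapping.single i m)}"

text \<open>The displayed identity already makes \<open>f\<close> homogeneous of degree \<open>m\<close>; the zero polynomial is
  admitted.\<close>

definition extended_Z_polynomial :: "nat \<Rightarrow> 'n::finite real_mpoly \<Rightarrow> bool" where
  "extended_Z_polynomial m f \<longleftrightarrow>
     (\<exists>(s :: nat) (\<Gamma> :: nat \<Rightarrow> 'n set).
        1 \<le> s \<and> s \<le> CARD('n) \<and>
        (\<Union>l\<in>{1..s}. \<Gamma> l) = UNIV \<and>
        (\<forall>l1\<in>{1..s}. \<forall>l2\<in>{1..s}. l1 \<noteq> l2 \<longrightarrow> \<Gamma> l1 \<inter> \<Gamma> l2 = {}) \<and>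
        f = (\<Sum>i\<in>UNIV. Poly_Mapping.single (Poly_Mapping.single i m)
                (Poly_Mapping.lookup f (Poly_Mapping.single i m)))
            + (\<Sum>l=1..s. \<Sum>\<alpha>\<in>mixed_indices m (\<Gamma> l). Poly_Mapping.single \<alpha> (Poly_Mapping.lookup f \<alpha>)) \<and>
        (\<forall>l\<in>{1..s}.
           (\<exists>\<beta>\<in>mixed_indices m (\<Gamma> l). \<forall>\<alpha>\<in>mixed_indices m (\<Gamma> l) - {\<beta>}. Poly_Mapping.lookup f \<alpha> = 0) \<or>
           (\<forall>\<alpha>\<in>mixed_indices m (\<Gamma> l). Poly_Mapping.lookup f \<alpha> \<le> 0)))"

definition extended_Z_tensor :: "nat \<Rightarrow> 'n::finite tensor \<Rightarrow> bool" where
  "extended_Z_tensor m A \<longleftrightarrow>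
     symmetric_tensor m A \<and> extended_Z_polynomial m (tensor_form m A)"

text \<open>Sanity checks: \<open>mixed_indices m G\<close> is finite, and the formal polynomial
  \<open>tensor_form m A\<close> evaluates to the usual expression for \<open>A x\<^sup>m\<close>.\<close>

lemma finite_mixed_indices: "finite (mixed_indices m (G :: 'n::finite set))"
proof -
  have "mixed_indices m G \<subseteq> {\<alpha>. Poly_Mapping.lookup \<alpha> \<in> (UNIV \<rightarrow> {..m})}"
    unfolding mixed_indices_def
    by (auto intro: member_le_sum)
  moreover have "finite {\<alpha> :: 'n \<Rightarrow>\<^sub>0 nat. Poly_Mapping.lookup \<alpha> \<in> (UNIV \<rightarrow> {..m})}"
  proof (rule finite_imageD)
    have "finite (PiE (UNIV :: 'n set) (\<lambda>_. {..m}))"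
      by (intro finite_PiE) auto
    then show "finite (Poly_Mapping.lookup ` {\<alpha> :: 'n \<Rightarrow>\<^sub>0 nat. Poly_Mapping.lookup \<alpha> \<in> (UNIV \<rightarrow> {..m})})"
      by (rule rev_finite_subset) (auto simp: PiE_def)
    show "inj_on Poly_Mapping.lookup {\<alpha> :: 'n \<Rightarrow>\<^sub>0 nat. Poly_Mapping.lookup \<alpha> \<in> (UNIV \<rightarrow> {..m})}"
      by (auto intro!: inj_onI poly_mapping_eqI)
  qed
  ultimately show ?thesis
    by (rule finite_subset)
qed

lemma mpoly_eval_superset:
  assumes "finite S" "Poly_Mapping.keys f \<subseteq> S"
  shows "mpoly_eval f x = (\<Sum>\<alpha>\<in>S. Poly_Mapping.lookup f \<alpha> * (\<Prod>i\<in>UNIV. (x $ i) ^ Poly_Mapping.lookup \<alpha> i))"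
  unfolding mpoly_eval_def
  by (rule sum.mono_neutral_left) (use assms in \<open>auto simp: in_keys_iff\<close>)

lemma mpoly_eval_add: "mpoly_eval (f + g) x = mpoly_eval f x + mpoly_eval g x"
proof -
  let ?S = "Poly_Mapping.keys f \<union> Poly_Mapping.keys g"
  have "Poly_Mapping.keys (f + g) \<subseteq> ?S"
    by (rule Poly_Mapping.keys_add)
  then show ?thesis
    by (simp add: mpoly_eval_superset[of ?S] lookup_add distrib_right sum.distrib)
qed

lemma mpoly_eval_sum: "mpoly_eval (\<Sum>j\<in>S. f j) x = (\<Sum>j\<in>S. mpoly_eval (f j) x)"
proof (induction S rule: infinite_finite_induct)
  case (insert j S)
  then show ?case
    by (simp add: mpoly_eval_add)
qed (simp_all add: mpoly_eval_def)

lemma mpoly_eval_single: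
  "mpoly_eval (Poly_Mapping.single \<alpha> c) x = c * (\<Prod>i\<in>UNIV. (x $ i) ^ Poly_Mapping.lookup \<alpha> i)"
  by (simp add: mpoly_eval_superset[of "{\<alpha>}"])

lemma prod_power_sum_list_single:
  fixes x :: "real ^ 'n"
  shows "(\<Prod>j\<in>UNIV. (x $ j) ^ Poly_Mapping.lookup (\<Sum>i\<leftarrow>is. Poly_Mapping.single i 1) j) = (\<Prod>i\<leftarrow>is. x $ i)"
proof (induction "is")
  case (Cons i "is")
  have "(\<Prod>j\<in>UNIV. (x $ j) ^ Poly_Mapping.lookup (Poly_Mapping.single i 1) j) =
        (\<Prod>j\<in>UNIV. if j = i then x $ j else 1)"
    by (intro prod.cong) (auto simp: lookup_single when_def)
  then show ?case
    using Cons by (simp add: lookup_add power_add prod.distrib)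
qed simp

lemma mpoly_eval_tensor_form:
  "mpoly_eval (tensor_form m A) x = (\<Sum>is | length is = m. A is * (\<Prod>i\<leftarrow>is. x $ i))"
  by (simp only: tensor_form_def mpoly_eval_sum mpoly_eval_single prod_power_sum_list_single)

end

theory Submission
  imports Defs
begin

text \<open>The blocks \<open>\<Gamma>\<^sub>l\<close> involve disjoint variables, so setting the other variables to \<open>0\<close> shows that each block
  is itself positive semi-definite and may be treated alone. A block with a single positive mixed
  term \<open>x\<^sup>\<beta>\<close> is a sum of even monomials if \<open>\<beta>\<close> is even; otherwise flipping the sign of one variable
  shows, as in the block with nonpositive coefficients, that for \<open>x \<ge> 0\<close> the diagonal dominates the sum
  of the terms \<open>\<bar>c\<^sub>\<alpha>\<bar> x\<^sup>\<alpha>\<close>. By convex separation the diagonal then splits into parts, each of which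
  dominates one term. A diagonal form dominating a single term \<open>\<bar>c\<bar> x\<^sup>\<alpha>\<close> is, up to scaling of the
  variables, a nonnegative combination of even powers and the AM-GM form
  \<open>\<Sum>i. \<alpha>\<^sub>i x\<^sub>i\<^sup>m - m x\<^sup>\<alpha>\<close>, which is a sum of squares by a theorem of Hurwitz and Reznick.\<close>

section \<open>Sums of squares\<close>

definition is_sos :: "'n real_mpoly \<Rightarrow> bool" where
  "is_sos f \<longleftrightarrow> (\<exists>gs. f = (\<Sum>g\<leftarrow>gs. g ^ 2))"

lemma is_sos_0 [simp]: "is_sos 0"
  unfolding is_sos_def by (rule exI[of _ "[]"]) simp

lemma is_sos_square: "is_sos (g ^ 2)"
  unfolding is_sos_def by (rule exI[of _ "[g]"]) simp

lemma is_sos_add: "is_sos f \<Longrightarrow> is_sos g \<Longrightarrow> is_sos (f + g)"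
  unfolding is_sos_def by (metis map_append sum_list_append)

lemma is_sos_sum: "(\<And>j. j \<in> S \<Longrightarrow> is_sos (f j)) \<Longrightarrow> is_sos (\<Sum>j\<in>S. f j)"
  by (induction S rule: infinite_finite_induct) (auto intro: is_sos_add)

text \<open>Scalars enter as constant polynomials \<open>single 0 k\<close>; the factor
  \<open>sqrt k\<close> is absorbed into each square.\<close>

lemma is_sos_scale:
  assumes "0 \<le> k" "is_sos f"
  shows "is_sos (Poly_Mapping.single 0 k * f)"
proof -
  obtain gs where "f = (\<Sum>g\<leftarrow>gs. g ^ 2)"
    using assms(2) unfolding is_sos_def by blast
  moreover have "Poly_Mapping.single 0 k = Poly_Mapping.single (0 :: 'a \<Rightarrow>\<^sub>0 nat) (sqrt k) ^ 2"
    using assms(1) by (simp add: power2_eq_square mult_single)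
  ultimately have "Poly_Mapping.single 0 k * f =
      (\<Sum>g\<leftarrow>map ((*) (Poly_Mapping.single 0 (sqrt k))) gs. g ^ 2)"
    by (simp add: power_mult_distrib sum_list_const_mult o_def)
  then show ?thesis
    unfolding is_sos_def by blast
qed

lemma is_sos_of_nat_mult: "is_sos f \<Longrightarrow> is_sos (of_nat k * f)"
  using is_sos_scale[of "real k" f] by simp

lemma is_sos_of_nat_multD:
  assumes "is_sos (of_nat k * f)" "k > 0"
  shows "is_sos f"
proof -
  have "Poly_Mapping.single 0 (1 / real k) * of_nat k = (1 :: 'a real_mpoly)"
    using assms(2) by (subst single_of_nat[symmetric], subst mult_single) simp
  then have "Poly_Mapping.single 0 (1 / real k) * (of_nat k * f) = f"
    by (simp add: mult.assoc[symmetric])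
  then show ?thesis
    using is_sos_scale[of "1 / real k" "of_nat k * f"] assms(1) by simp
qed

lemma is_sos_single_double:
  assumes "0 \<le> c"
  shows "is_sos (Poly_Mapping.single (\<beta> + \<beta>) c)"
proof -
  have "Poly_Mapping.single (\<beta> + \<beta>) c = Poly_Mapping.single \<beta> (sqrt c) ^ 2"
    using assms by (simp add: power2_eq_square mult_single)
  then show ?thesis
    by (simp add: is_sos_square)
qed

lemma is_sos_diagonal:
  assumes "even m" "\<And>i. 0 \<le> b i"
  shows "is_sos (\<Sum>i\<in>(UNIV :: 'n::finite set). Poly_Mapping.single (Poly_Mapping.single i m) (b i))"
proof (rule is_sos_sum)
  fix i :: 'n
  obtain d where "m = d + d"
    using assms(1) by (metis evenE mult_2)
  then show "is_sos (Poly_Mapping.single (Poly_Mapping.single i m) (b i))"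
    using is_sos_single_double[of "b i" "Poly_Mapping.single i d"] assms(2)
    by (simp add: single_add)
qed

text \<open>Following the chosen successors, finiteness of \<open>V\<close> leads to a cycle.
  Telescoping around the cycle gives a positive multiple of \<open>g u\<close>, and telescoping
  along the path from \<open>v\<close> to \<open>u\<close> carries the result back to
  \<open>v\<close>.\<close>

lemma is_sos_of_orbits:
  assumes "finite V"
    and step: "\<And>v. v \<in> V \<Longrightarrow> \<exists>u\<in>V. is_sos (2 * g v - g u)"
    and "v \<in> V"
  shows "is_sos (g v)"
proof -
  obtain \<phi> where \<phi>: "\<And>v. v \<in> V \<Longrightarrow> \<phi> v \<in> V \<and> is_sos (2 * g v - g (\<phi> v))"
    using step by metis
  have orbit: "(\<phi> ^^ N) u \<in> V \<and> is_sos (of_nat (2 ^ N) * g u - g ((\<phi> ^^ N) u))" if "u \<in> V" for N u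
  proof (induction N)
    case 0
    then show ?case using that by simp
  next
    case (Suc N)
    let ?w = "(\<phi> ^^ N) u"
    have "is_sos (of_nat 2 * (of_nat (2 ^ N) * g u - g ?w) + (2 * g ?w - g (\<phi> ?w)))"
      using Suc \<phi>[of ?w] by (blast intro: is_sos_add is_sos_of_nat_mult)
    then show ?case
      using Suc \<phi>[of ?w] by (simp add: algebra_simps)
  qed
  \<comment> \<open>Pigeonhole: an injective orbit would embed the natural numbers into
    \<open>V\<close>.\<close>
  have "\<not> inj_on (\<lambda>N. (\<phi> ^^ N) v) UNIV"
    using assms(1,3) orbit by (metis finite_imageD finite_subset image_subsetI infinite_UNIV_nat)
  then obtain i j where ij: "i < j" "(\<phi> ^^ i) v = (\<phi> ^^ j) v"
    unfolding inj_on_def by (metis linorder_neqE_nat)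
  define u where "u = (\<phi> ^^ i) v"
  define k where "k = j - i"
  have u: "u \<in> V" "(\<phi> ^^ k) u = u"
  proof -
    show "u \<in> V"
      using orbit assms(3) u_def by blast
    have "(\<phi> ^^ k) u = (\<phi> ^^ (k + i)) v"
      by (simp add: u_def funpow_add)
    then show "(\<phi> ^^ k) u = u"
      using ij by (simp add: k_def u_def)
  qed
  \<comment> \<open>As \<open>u\<close> returns to itself after \<open>k\<close> steps, this is
    \<open>2 ^ k - 1\<close> times \<open>g u\<close>; the factor is positive because
    \<open>i < j\<close>.\<close>
  have "is_sos (of_nat (2 ^ k) * g u - g u)"
    using orbit[OF u(1), of k] u(2) by simp
  moreover have "of_nat (2 ^ k) * g u - g u = of_nat (2 ^ k - 1) * g u"
    by (simp add: of_nat_diff algebra_simps)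
  ultimately have "is_sos (g u)"
    using is_sos_of_nat_multD[of "2 ^ k - 1" "g u"] one_less_power[of "2 :: nat" k] ij(1)
    by (simp add: k_def)
  then have "is_sos (of_nat (2 ^ i) * g v)"
    using is_sos_add[of "of_nat (2 ^ i) * g v - g u" "g u"] orbit[OF assms(3), of i]
    by (simp add: u_def)
  then show ?thesis
    using is_sos_of_nat_multD by (metis zero_less_power pos2)
qed

section \<open>Agiforms are sums of squares\<close>

abbreviation weight :: "('n::finite \<Rightarrow>\<^sub>0 nat) \<Rightarrow> nat" where
  "weight \<alpha> \<equiv> (\<Sum>i\<in>UNIV. Poly_Mapping.lookup \<alpha> i)"

lemma weight_add: "weight (\<alpha> + \<beta>) = weight \<alpha> + weight \<beta>"
  by (simp add: lookup_add sum.distrib)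

lemma weight_single [simp]: "weight (Poly_Mapping.single i k) = k"
  by (simp add: lookup_single when_def)

lemma finite_weight_eq: "finite {\<alpha> :: 'n::finite \<Rightarrow>\<^sub>0 nat. weight \<alpha> = m}"
proof (rule finite_subset)
  show "{\<alpha> :: 'n \<Rightarrow>\<^sub>0 nat. weight \<alpha> = m} \<subseteq>
      mixed_indices m UNIV \<union> range (\<lambda>i. Poly_Mapping.single i m)"
    by (auto simp: mixed_indices_def)
qed (simp add: finite_mixed_indices)

lemma weight_split:
  fixes \<alpha> :: "'n::finite \<Rightarrow>\<^sub>0 nat"
  assumes "k \<le> weight \<alpha>"
  obtains \<beta> \<gamma> where "\<alpha> = \<beta> + \<gamma>" "weight \<beta> = k"
proof -
  have "\<exists>\<beta> \<gamma>. \<alpha> = \<beta> + \<gamma> \<and> weight \<beta> = k"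
    using assms
  proof (induction k)
    case 0
    show ?case by (rule exI[of _ 0]) simp
  next
    case (Suc k)
    then obtain \<beta> \<gamma> where IH: "\<alpha> = \<beta> + \<gamma>" "weight \<beta> = k"
      by auto
    then have "weight \<gamma> > 0"
      using Suc.prems weight_add[of \<beta> \<gamma>] by simp
    then obtain i where i: "Poly_Mapping.lookup \<gamma> i > 0"
      by (metis gr0I sum.neutral)
    have "\<gamma> = Poly_Mapping.single i 1 + (\<gamma> - Poly_Mapping.single i 1)"
      by (rule poly_mapping_eqI)
        (use i in \<open>auto simp: lookup_add lookup_minus lookup_single when_def\<close>)
    then have "\<alpha> = (\<beta> + Poly_Mapping.single i 1) + (\<gamma> - Poly_Mapping.single i 1)"
      using IH(1) by (metis add.assoc)
    moreover have "weight (\<beta> + Poly_Mapping.single i 1) = Suc k"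
      using IH(2) by (simp only: weight_add weight_single)
    ultimately show ?case by blast
  qed
  then show ?thesis
    using that by blast
qed

lemma keys_add_nat: "Poly_Mapping.keys (\<alpha> + \<beta> :: 'a \<Rightarrow>\<^sub>0 nat) = Poly_Mapping.keys \<alpha> \<union> Poly_Mapping.keys \<beta>"
  by (auto simp: in_keys_iff lookup_add)

text \<open>Some index \<open>i\<close> in the support has exponent at most \<open>d\<close>.
  Reserving all of that exponent for \<gamma> leaves enough weight to carve out \<beta>, which
  therefore misses \<open>i\<close>.\<close>

lemma weight_split_half:
  fixes \<alpha> :: "'n::finite \<Rightarrow>\<^sub>0 nat"
  assumes "weight \<alpha> = 2 * d" "\<And>i. \<alpha> \<noteq> Poly_Mapping.single i (2 * d)"
  obtains \<beta> \<gamma> where "\<alpha> = \<beta> + \<gamma>" "weight \<beta> = d" "weight \<gamma> = d"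
    "Poly_Mapping.keys \<beta> \<subset> Poly_Mapping.keys \<alpha>"
proof -
  have "\<exists>i\<in>Poly_Mapping.keys \<alpha>. Poly_Mapping.lookup \<alpha> i \<le> d"
  proof (rule ccontr)
    assume "\<not> ?thesis"
    then have big: "\<And>i. i \<in> Poly_Mapping.keys \<alpha> \<Longrightarrow> d < Poly_Mapping.lookup \<alpha> i"
      by auto
    have "\<alpha> \<noteq> 0"
      using assms by (metis mult_eq_0_iff single_zero lookup_zero sum.neutral)
    then obtain i where i: "i \<in> Poly_Mapping.keys \<alpha>"
      by (meson ex_in_conv keys_eq_empty)
    \<comment> \<open>Two exponents above \<open>d\<close> would exceed the weight
      \<open>2 * d\<close>, so \<alpha> would be a pure power.\<close>
    have rest: "Poly_Mapping.lookup \<alpha> j = 0" if "j \<noteq> i" for j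
    proof (rule ccontr)
      assume "Poly_Mapping.lookup \<alpha> j \<noteq> 0"
      then have "d < Poly_Mapping.lookup \<alpha> j" "d < Poly_Mapping.lookup \<alpha> i"
        using big i by (auto simp: in_keys_iff)
      moreover have "sum (Poly_Mapping.lookup \<alpha>) {i, j} \<le> weight \<alpha>"
        by (rule sum_mono2) auto
      ultimately show False
        using assms(1) that by simp
    qed
    then have eq: "\<alpha> = Poly_Mapping.single i (Poly_Mapping.lookup \<alpha> i)"
      by (intro poly_mapping_eqI) (auto simp: lookup_single when_def)
    have i: "Poly_Mapping.lookup \<alpha> i = 2 * d"
      using arg_cong[OF eq, of "\<lambda>a. weight a"] assms(1) by (simp only: weight_single)
    then show False
      using eq[unfolded i] assms(2) by blast
  qed
  then obtain i where i: "i \<in> Poly_Mapping.keys \<alpha>" "Poly_Mapping.lookup \<alpha> i \<le> d"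
    by blast
  define \<delta> where "\<delta> = \<alpha> - Poly_Mapping.single i (Poly_Mapping.lookup \<alpha> i)"
  have \<alpha>: "\<alpha> = \<delta> + Poly_Mapping.single i (Poly_Mapping.lookup \<alpha> i)"
    by (rule poly_mapping_eqI)
      (auto simp: \<delta>_def lookup_add lookup_minus lookup_single when_def)
  have "weight \<alpha> = weight \<delta> + Poly_Mapping.lookup \<alpha> i"
    using arg_cong[OF \<alpha>, of "\<lambda>a. weight a"] by (simp only: weight_add weight_single)
  then have "d \<le> weight \<delta>"
    using i(2) assms(1) by linarith
  then obtain \<beta> \<gamma> where \<beta>\<gamma>: "\<delta> = \<beta> + \<gamma>" "weight \<beta> = d"
    by (rule weight_split)
  let ?\<gamma> = "\<gamma> + Poly_Mapping.single i (Poly_Mapping.lookup \<alpha> i)"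
  have split: "\<alpha> = \<beta> + ?\<gamma>"
    using \<alpha> unfolding \<beta>\<gamma>(1) add.assoc .
  have \<gamma>: "weight ?\<gamma> = d"
    using arg_cong[OF split, of "\<lambda>a. weight a"] weight_add[of \<beta> ?\<gamma>] \<beta>\<gamma>(2) assms(1) by linarith
  have "i \<notin> Poly_Mapping.keys \<beta>"
  proof -
    have "Poly_Mapping.lookup \<delta> i = 0"
      by (simp add: \<delta>_def lookup_minus)
    then show ?thesis
      using \<beta>\<gamma>(1) by (simp add: in_keys_iff lookup_add)
  qed
  moreover have "Poly_Mapping.keys \<beta> \<subseteq> Poly_Mapping.keys \<alpha>"
    using arg_cong[OF split, of Poly_Mapping.keys] unfolding keys_add_nat by (metis Un_upper1)
  ultimately have "Poly_Mapping.keys \<beta> \<subset> Poly_Mapping.keys \<alpha>"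
    using i(1) by blast
  then show ?thesis
    by (rule that[OF split \<beta>\<gamma>(2) \<gamma>])
qed

section \<open>Scaled agiforms and the halving identity\<close>

definition monom_val :: "('n::finite \<Rightarrow> real) \<Rightarrow> ('n \<Rightarrow>\<^sub>0 nat) \<Rightarrow> real" where
  "monom_val t \<alpha> = (\<Prod>i\<in>UNIV. t i ^ Poly_Mapping.lookup \<alpha> i)"

lemma monom_val_add: "monom_val t (\<alpha> + \<beta>) = monom_val t \<alpha> * monom_val t \<beta>"
  by (simp add: monom_val_def lookup_add power_add prod.distrib)

lemma monom_val_single [simp]: "monom_val t (Poly_Mapping.single i k) = t i ^ k"
proof -
  have "monom_val t (Poly_Mapping.single i k) = (\<Prod>j\<in>UNIV. if j = i then t j ^ k else 1)"
    unfolding monom_val_def by (intro prod.cong) (auto simp: lookup_single when_def)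
  then show ?thesis by simp
qed

text \<open>For \<open>s = -1\<close> this is \<open>m\<close> times Reznick's agiform, that is \<open>\<Sum>i. \<alpha>\<^sub>i z\<^sub>i\<^sup>m + s m z\<^sup>\<alpha>\<close> after the substitution \<open>z\<^sub>i = t\<^sub>i x\<^sub>i\<close>; the
  scaling \<open>t\<close> is built in so that no substitution homomorphism is needed.\<close>

definition agiform :: "nat \<Rightarrow> ('n::finite \<Rightarrow> real) \<Rightarrow> real \<Rightarrow> ('n \<Rightarrow>\<^sub>0 nat) \<Rightarrow> 'n real_mpoly" where
  "agiform m t s \<alpha> =
     (\<Sum>i\<in>UNIV. Poly_Mapping.single (Poly_Mapping.single i m) (real (Poly_Mapping.lookup \<alpha> i) * t i ^ m))
     + Poly_Mapping.single \<alpha> (s * m * monom_val t \<alpha>)"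

text \<open>At a pure power the second summand cancels the diagonal. This covers the multi-indices
  excluded in \<open>weight_split_half\<close>.\<close>

lemma agiform_pure [simp]: "agiform m t (-1) (Poly_Mapping.single i m) = 0"
proof -
  have "(\<Sum>j\<in>UNIV. Poly_Mapping.single (Poly_Mapping.single j m)
          (real (Poly_Mapping.lookup (Poly_Mapping.single i m) j) * t j ^ m)) =
        (\<Sum>j\<in>UNIV. if j = i then Poly_Mapping.single (Poly_Mapping.single i m) (m * t i ^ m) else 0)"
    by (intro sum.cong) (auto simp: lookup_single when_def)
  then show ?thesis
    by (simp add: agiform_def single_add[symmetric])
qed

text \<open>The diagonal is linear in the multi-index, so it distributes over the doubled parts.
  Their mixed terms cancel the pure squares of the binomial, whose cross term is the remaining
  summand.\<close>

lemma agiform_halving: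
  fixes \<beta> \<gamma> :: "'n::finite \<Rightarrow>\<^sub>0 nat"
  assumes "s ^ 2 = 1"
  shows "2 * agiform m t s (\<beta> + \<gamma>) = agiform m t (-1) (\<beta> + \<beta>) + agiform m t (-1) (\<gamma> + \<gamma>)
    + of_nat m * (Poly_Mapping.single \<beta> (monom_val t \<beta>) + Poly_Mapping.single \<gamma> (s * monom_val t \<gamma>)) ^ 2"
proof -
  let ?e = "\<lambda>i. Poly_Mapping.single (i :: 'n) m"
  let ?p = "Poly_Mapping.single \<beta> (monom_val t \<beta>)" and ?q = "Poly_Mapping.single \<gamma> (s * monom_val t \<gamma>)"
  have two: "2 * Poly_Mapping.single a c = Poly_Mapping.single a (2 * c)" for a and c :: real
    by (simp only: mult_2 single_add)
  have s: "s * (s * x) = x" for x :: real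
    using assms by (metis mult.assoc mult_1 power2_eq_square)
  have "2 * (\<Sum>i\<in>UNIV. Poly_Mapping.single (?e i) (real (Poly_Mapping.lookup (\<beta> + \<gamma>) i) * t i ^ m)) =
      (\<Sum>i\<in>UNIV. Poly_Mapping.single (?e i) (real (Poly_Mapping.lookup (\<beta> + \<beta>) i) * t i ^ m)) +
      (\<Sum>i\<in>UNIV. Poly_Mapping.single (?e i) (real (Poly_Mapping.lookup (\<gamma> + \<gamma>) i) * t i ^ m))"
    by (simp only: sum_distrib_left sum.distrib[symmetric] two single_add[symmetric])
      (simp add: lookup_add algebra_simps)
  moreover have "of_nat m * (?p + ?q) ^ 2 =
      Poly_Mapping.single (\<beta> + \<beta>) (m * monom_val t (\<beta> + \<beta>))
      + Poly_Mapping.single (\<gamma> + \<gamma>) (m * monom_val t (\<gamma> + \<gamma>))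
      + Poly_Mapping.single (\<beta> + \<gamma>) (2 * (s * m * monom_val t (\<beta> + \<gamma>)))"
  proof -
    have "of_nat m * (?p + ?q) ^ 2 = of_nat m * (?p * ?p) + of_nat m * (?q * ?q) + 2 * (of_nat m * (?p * ?q))"
      by (simp add: power2_eq_square algebra_simps)
    moreover have "of_nat m * Poly_Mapping.single a c = Poly_Mapping.single a (m * c)"
      for a :: "'n \<Rightarrow>\<^sub>0 nat" and c :: real
      by (simp only: single_of_nat[symmetric] mult_single add_0)
    moreover have "s * monom_val t \<gamma> * (s * monom_val t \<gamma>) = monom_val t (\<gamma> + \<gamma>)"
      using s[of "monom_val t \<gamma> * monom_val t \<gamma>"] by (simp add: monom_val_add mult.left_commute mult.assoc)
    moreover have "m * (monom_val t \<beta> * (s * monom_val t \<gamma>)) = s * m * monom_val t (\<beta> + \<gamma>)"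
      by (simp add: monom_val_add mult.left_commute mult.assoc)
    ultimately show ?thesis
      by (simp only: mult_single two monom_val_add[of t \<beta> \<beta>])
  qed
  ultimately show ?thesis
    unfolding agiform_def distrib_left two by (simp add: single_uminus)
qed

text \<open>Halving \<open>\<alpha> = \<beta> + \<gamma>\<close> expresses the agiform of \<open>\<alpha>\<close> by a square and those of \<open>2\<beta>\<close> and \<open>2\<gamma>\<close>. Choosing \<open>\<beta>\<close> of
  smaller support, induction handles \<open>2\<beta>\<close>; the map \<open>\<alpha> \<mapsto> 2\<gamma>\<close> on the finite set of multi-indices
  of weight \<open>m\<close> is eventually periodic, and around a cycle of length \<open>k\<close> one gets that \<open>(2\<^sup>k - 1)\<close> times the
  agiform is a sum of squares.\<close>

theorem is_sos_agiform_minus: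
  fixes \<alpha> :: "'n::finite \<Rightarrow>\<^sub>0 nat"
  assumes "weight \<alpha> = 2 * d"
  shows "is_sos (agiform (2 * d) t (-1) \<alpha>)"
  using assms
proof (induction "card (Poly_Mapping.keys \<alpha>)" arbitrary: \<alpha> rule: less_induct)
  case less
  \<comment> \<open>The non-strict bound keeps \<open>?V\<close> closed under passing to \<gamma> +
    \<gamma>, whose support need not shrink, while \<beta> + \<beta> has strictly smaller support
    and falls to the induction hypothesis.\<close>
  let ?V = "{\<beta> :: 'n \<Rightarrow>\<^sub>0 nat. weight \<beta> = 2 * d \<and> card (Poly_Mapping.keys \<beta>) \<le> card (Poly_Mapping.keys \<alpha>)}"
  let ?g = "agiform (2 * d) t (-1)"
  have "finite ?V"
    by (rule finite_subset[OF _ finite_weight_eq[of "2 * d"]]) auto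
  moreover have "\<exists>u\<in>?V. is_sos (2 * ?g v - ?g u)" if v: "v \<in> ?V" for v
  proof (cases "\<exists>i. v = Poly_Mapping.single i (2 * d)")
    case True
    then have "is_sos (2 * ?g v - ?g v)"
      by auto
    then show ?thesis
      using v by blast
  next
    case False
    then obtain \<beta> \<gamma> where \<beta>\<gamma>: "v = \<beta> + \<gamma>" "weight \<beta> = d" "weight \<gamma> = d"
      "Poly_Mapping.keys \<beta> \<subset> Poly_Mapping.keys v"
      using weight_split_half[of v d] v by blast
    have "card (Poly_Mapping.keys (\<beta> + \<beta>)) < card (Poly_Mapping.keys v)"
      unfolding keys_add_nat using \<beta>\<gamma>(4) by (simp add: psubset_card_mono)
    then have \<beta>: "is_sos (?g (\<beta> + \<beta>))"
      using less.hyps[of "\<beta> + \<beta>"] v \<beta>\<gamma>(2) weight_add[of \<beta> \<beta>] by simp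
    have "card (Poly_Mapping.keys (\<gamma> + \<gamma>)) \<le> card (Poly_Mapping.keys v)"
      unfolding \<beta>\<gamma>(1) keys_add_nat by (intro card_mono) auto
    then have "\<gamma> + \<gamma> \<in> ?V"
      using v \<beta>\<gamma>(3) weight_add[of \<gamma> \<gamma>] by simp
    moreover have "is_sos (2 * ?g v - ?g (\<gamma> + \<gamma>))"
    proof -
      have "2 * ?g v - ?g (\<gamma> + \<gamma>) = ?g (\<beta> + \<beta>) + of_nat (2 * d) *
          (Poly_Mapping.single \<beta> (monom_val t \<beta>) + Poly_Mapping.single \<gamma> (-1 * monom_val t \<gamma>)) ^ 2"
        unfolding \<beta>\<gamma>(1) diff_eq_eq by (subst agiform_halving) (simp_all only: power2_minus one_power2 ac_simps)
      then show ?thesis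
        using \<beta> by (simp only:) (intro is_sos_add is_sos_of_nat_mult is_sos_square)
    qed
    ultimately show ?thesis by blast
  qed
  moreover have "\<alpha> \<in> ?V"
    using less.prems by simp
  ultimately show ?case
    by (rule is_sos_of_orbits)
qed

text \<open>A single halving, with any split into equal weights, reduces either sign to agiforms
  with sign -1.\<close>

theorem is_sos_agiform:
  fixes \<alpha> :: "'n::finite \<Rightarrow>\<^sub>0 nat"
  assumes "weight \<alpha> = m" "even m" "s ^ 2 = 1"
  shows "is_sos (agiform m t s \<alpha>)"
proof -
  obtain d where d: "m = 2 * d"
    using assms(2) by blast
  then have "d \<le> weight \<alpha>"
    using assms(1) by simp
  then obtain \<beta> \<gamma> where \<beta>\<gamma>: "\<alpha> = \<beta> + \<gamma>" "weight \<beta> = d"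
    by (rule weight_split)
  then have "weight \<gamma> = d"
    using assms(1) d weight_add[of \<beta> \<gamma>] by simp
  then have "is_sos (2 * agiform m t s \<alpha>)"
    unfolding \<beta>\<gamma>(1) agiform_halving[OF assms(3)] d
    using \<beta>\<gamma>(2) weight_add[of \<beta> \<beta>] weight_add[of \<gamma> \<gamma>]
    by (intro is_sos_add is_sos_of_nat_mult is_sos_square is_sos_agiform_minus) simp_all
  then show ?thesis
    using is_sos_of_nat_multD[of 2] by simp
qed

section \<open>Splitting the diagonal\<close>

lemma monom_val_nonneg: "(\<And>i. 0 \<le> x i) \<Longrightarrow> 0 \<le> monom_val x \<alpha>"
  by (simp add: monom_val_def prod_nonneg)

lemma monom_val_pos: "(\<And>i. 0 < x i) \<Longrightarrow> 0 < monom_val x \<alpha>"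
  by (simp add: monom_val_def prod_pos)

lemma monom_val_mult: "monom_val (\<lambda>i. x i * y i) \<alpha> = monom_val x \<alpha> * monom_val y \<alpha>"
  by (simp add: monom_val_def power_mult_distrib prod.distrib)

lemma monom_val_le_weighted_mean:
  fixes \<alpha> :: "'n::finite \<Rightarrow>\<^sub>0 nat" and z :: "'n \<Rightarrow> real"
  assumes "weight \<alpha> = m" "m > 0" and z: "\<And>i. 0 \<le> z i"
  shows "m * monom_val z \<alpha> \<le> (\<Sum>i\<in>UNIV. Poly_Mapping.lookup \<alpha> i * z i ^ m)"
proof (cases "\<exists>i. Poly_Mapping.lookup \<alpha> i > 0 \<and> z i = 0")
  case True
  then have "monom_val z \<alpha> = 0"
    by (auto simp: monom_val_def)
  then show ?thesis
    using z by (simp add: sum_nonneg)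
next
  case False
  let ?S = "Poly_Mapping.keys \<alpha>"
  have pos: "0 < z i" if "i \<in> ?S" for i
  proof -
    have "z i \<noteq> 0"
      using False that unfolding in_keys_iff by blast
    then show ?thesis
      using z[of i] by simp
  qed
  have "(\<Sum>i\<in>?S. Poly_Mapping.lookup \<alpha> i) = weight \<alpha>"
    by (rule sum.mono_neutral_left) (auto simp: in_keys_iff)
  then have wS: "(\<Sum>i\<in>?S. Poly_Mapping.lookup \<alpha> i) = m"
    by (simp only: assms(1))
  then have "?S \<noteq> {}"
    using assms(2) by auto
  have "monom_val z \<alpha> = (\<Prod>i\<in>?S. z i ^ Poly_Mapping.lookup \<alpha> i)"
    unfolding monom_val_def by (rule prod.mono_neutral_right) (auto simp: in_keys_iff)
  also have "\<dots> = (\<Prod>i\<in>?S. exp (Poly_Mapping.lookup \<alpha> i * ln (z i)))"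
    by (intro prod.cong refl) (simp add: exp_of_nat_mult pos)
  also have "\<dots> = exp (\<Sum>i\<in>?S. (Poly_Mapping.lookup \<alpha> i / m) *\<^sub>R (m * ln (z i)))"
    using assms(2) by (simp add: exp_sum)
  also have "\<dots> \<le> (\<Sum>i\<in>?S. (Poly_Mapping.lookup \<alpha> i / m) * exp (m * ln (z i)))"
  proof (rule convex_on_sum[OF _ \<open>?S \<noteq> {}\<close> exp_convex])
    show "(\<Sum>i\<in>?S. real (Poly_Mapping.lookup \<alpha> i) / real m) = 1"
      using wS assms(2) by (simp add: sum_divide_distrib[symmetric] of_nat_sum[symmetric] del: of_nat_sum)
  qed auto
  also have "\<dots> = (\<Sum>i\<in>?S. Poly_Mapping.lookup \<alpha> i * z i ^ m) / m"
    unfolding sum_divide_distrib by (intro sum.cong refl) (simp add: exp_of_nat_mult pos)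
  also have "(\<Sum>i\<in>?S. Poly_Mapping.lookup \<alpha> i * z i ^ m) = (\<Sum>i\<in>UNIV. Poly_Mapping.lookup \<alpha> i * z i ^ m)"
    by (rule sum.mono_neutral_left) (auto simp: in_keys_iff)
  finally show ?thesis
    using assms(2) by (simp add: field_simps)
qed

text \<open>The coefficients \<open>d\<close> form a Euclidean vector because they are later
  separated by a hyperplane; the points \<open>x\<close> remain functions. Nonnegativity of
  \<open>d\<close> will make sums of these sets closed.\<close>

definition dominating :: "nat \<Rightarrow> real \<Rightarrow> ('n::finite \<Rightarrow>\<^sub>0 nat) \<Rightarrow> (real ^ 'n) set" where
  "dominating m c \<alpha> =
     {d. (\<forall>i. 0 \<le> d $ i) \<and> (\<forall>x. (\<forall>i. 0 \<le> x i) \<longrightarrow> \<bar>c\<bar> * monom_val x \<alpha> \<le> (\<Sum>i\<in>UNIV. d $ i * x i ^ m))}"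

lemma dominating_nonneg: "d \<in> dominating m c \<alpha> \<Longrightarrow> 0 \<le> d $ i"
  by (simp add: dominating_def)

lemma dominatingD:
  "d \<in> dominating m c \<alpha> \<Longrightarrow> (\<And>i. 0 \<le> x i) \<Longrightarrow> \<bar>c\<bar> * monom_val x \<alpha> \<le> (\<Sum>i\<in>UNIV. d $ i * x i ^ m)"
  by (simp add: dominating_def)

lemma convex_dominating: "convex (dominating m c \<alpha>)"
proof (rule convexI)
  fix d e :: "real ^ 'a" and u v :: real
  assume de: "d \<in> dominating m c \<alpha>" "e \<in> dominating m c \<alpha>" and uv: "0 \<le> u" "0 \<le> v" "u + v = 1"
  have "\<bar>c\<bar> * monom_val x \<alpha> \<le> (\<Sum>i\<in>UNIV. (u *\<^sub>R d + v *\<^sub>R e) $ i * x i ^ m)" if x: "\<forall>i. 0 \<le> x i" for x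
  proof -
    have "\<bar>c\<bar> * monom_val x \<alpha> = u * (\<bar>c\<bar> * monom_val x \<alpha>) + v * (\<bar>c\<bar> * monom_val x \<alpha>)"
      using uv(3) by (simp add: distrib_right[symmetric])
    also have "\<dots> \<le> u * (\<Sum>i\<in>UNIV. d $ i * x i ^ m) + v * (\<Sum>i\<in>UNIV. e $ i * x i ^ m)"
      using de uv x by (intro add_mono mult_left_mono) (auto simp: dominating_def)
    finally show ?thesis
      by (simp add: sum_distrib_left sum.distrib distrib_right mult.assoc)
  qed
  then show "u *\<^sub>R d + v *\<^sub>R e \<in> dominating m c \<alpha>"
    using de uv by (simp add: dominating_def)
qed

lemma closed_dominating: "closed (dominating m c \<alpha>)"
proof -
  have "dominating m c \<alpha> = (\<Inter>i. {d. 0 \<le> d $ i}) \<inter>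
      (\<Inter>x\<in>{x. \<forall>i. 0 \<le> x i}. {d. \<bar>c\<bar> * monom_val x \<alpha> \<le> (\<Sum>i\<in>UNIV. d $ i * x i ^ m)})"
    by (auto simp: dominating_def)
  also have "closed \<dots>"
    by (intro closed_Int closed_INT ballI closed_Collect_le continuous_intros)
  finally show ?thesis .
qed

text \<open>The coefficients of the weighted AM-GM inequality that is tangent at \<open>x\<close>.\<close>

definition tangent :: "nat \<Rightarrow> real \<Rightarrow> ('n::finite \<Rightarrow>\<^sub>0 nat) \<Rightarrow> ('n \<Rightarrow> real) \<Rightarrow> real ^ 'n" where
  "tangent m c \<alpha> x = (\<chi> i. \<bar>c\<bar> * monom_val x \<alpha> * Poly_Mapping.lookup \<alpha> i / (m * x i ^ m))"

text \<open>The substitution \<open>y i = x i * z i\<close> turns the claim into weighted AM-GM for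
  \<open>z\<close>, with equality at \<open>z = 1\<close>, that is, at \<open>x\<close>.\<close>

lemma tangent_in_dominating:
  fixes \<alpha> :: "'n::finite \<Rightarrow>\<^sub>0 nat"
  assumes "weight \<alpha> = m" "m > 0" and x: "\<And>i. 0 < x i"
  shows "tangent m c \<alpha> x \<in> dominating m c \<alpha>"
    and "(\<Sum>i\<in>UNIV. tangent m c \<alpha> x $ i * x i ^ m) = \<bar>c\<bar> * monom_val x \<alpha>"
proof -
  let ?d = "tangent m c \<alpha> x"
  have eq: "(\<Sum>i\<in>UNIV. ?d $ i * (x i * z i) ^ m) =
      \<bar>c\<bar> * monom_val x \<alpha> / m * (\<Sum>i\<in>UNIV. Poly_Mapping.lookup \<alpha> i * z i ^ m)" for z :: "'n \<Rightarrow> real"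
    unfolding sum_distrib_left
    by (intro sum.cong refl) (use x in \<open>simp add: tangent_def power_mult_distrib less_imp_neq[symmetric]\<close>)
  have "\<bar>c\<bar> * monom_val y \<alpha> \<le> (\<Sum>i\<in>UNIV. ?d $ i * y i ^ m)" if y: "\<forall>i. 0 \<le> y i" for y
  proof -
    define z where "z i = y i / x i" for i
    have yz: "y = (\<lambda>i. x i * z i)"
      using x by (auto simp: z_def less_imp_neq[symmetric])
    have z: "0 \<le> z i" for i
      using x[of i] y by (simp add: z_def)
    have "\<bar>c\<bar> * monom_val y \<alpha> = \<bar>c\<bar> * monom_val x \<alpha> / m * (m * monom_val z \<alpha>)"
      using assms(2) by (simp add: yz monom_val_mult)
    also have "\<dots> \<le> \<bar>c\<bar> * monom_val x \<alpha> / m * (\<Sum>i\<in>UNIV. Poly_Mapping.lookup \<alpha> i * z i ^ m)"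
      using monom_val_pos[of x \<alpha>] x
      by (intro mult_left_mono monom_val_le_weighted_mean[OF assms(1,2) z]) simp_all
    finally show ?thesis
      by (simp add: yz eq)
  qed
  then show "?d \<in> dominating m c \<alpha>"
    using x by (simp add: dominating_def tangent_def monom_val_nonneg less_imp_le)
  show "(\<Sum>i\<in>UNIV. ?d $ i * x i ^ m) = \<bar>c\<bar> * monom_val x \<alpha>"
    using eq[of "\<lambda>_. 1"] assms(1,2) by (simp add: of_nat_sum[symmetric] del: of_nat_sum)
qed

text \<open>If \<open>d $ i\<close> were 0, letting the coordinate \<open>i\<close> grow with all
  others equal to 1 would leave the diagonal fixed while the monomial is unbounded.\<close>

lemma dominating_support_pos:
  assumes d: "d \<in> dominating m c \<alpha>" and "c \<noteq> 0" "m > 0" "Poly_Mapping.lookup \<alpha> i > 0"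
  shows "0 < d $ i"
proof (rule ccontr)
  assume "\<not> 0 < d $ i"
  then have di: "d $ i = 0"
    using dominating_nonneg[OF d, of i] by linarith
  define B where "B = (\<Sum>j\<in>UNIV. d $ j)"
  \<comment> \<open>Chosen so that \<open>\<bar>c\<bar> * t\<close> exceeds \<open>B\<close>, and at
    least 1 so that \<open>t\<close> is bounded by its positive powers.\<close>
  define t where "t = B / \<bar>c\<bar> + 1"
  have "0 \<le> B"
    using d by (auto simp: B_def dominating_def intro: sum_nonneg)
  then have t: "1 \<le> t"
    by (simp add: t_def)
  define x where "x j = (if j = i then t else 1)" for j
  have "monom_val x \<alpha> = (\<Prod>j\<in>UNIV. if j = i then t ^ Poly_Mapping.lookup \<alpha> j else 1)"
    unfolding monom_val_def by (intro prod.cong) (auto simp: x_def)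
  then have "monom_val x \<alpha> = t ^ Poly_Mapping.lookup \<alpha> i"
    by simp
  then have "t \<le> monom_val x \<alpha>"
    using t assms(4) by (simp add: self_le_power)
  then have "\<bar>c\<bar> * t \<le> \<bar>c\<bar> * monom_val x \<alpha>"
    by (simp add: mult_left_mono)
  also have "\<dots> \<le> (\<Sum>j\<in>UNIV. d $ j * x j ^ m)"
    using t by (intro dominatingD[OF d]) (simp add: x_def)
  also have "\<dots> = B"
    unfolding B_def by (intro sum.cong) (auto simp: x_def di)
  finally show False
    using assms(2) by (simp add: t_def distrib_left)
qed

text \<open>The scaling \<open>t\<close> matches the agiform's diagonal to \<open>d\<close> on the
  support of \<alpha>. Domination at the reciprocal point bounds \<open>\<bar>c\<bar>\<close> by the
  agiform's mixed coefficient, so a multiple \<open>k \<le> 1\<close> of the agiform suffices and a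
  nonnegative diagonal remains.\<close>

theorem is_sos_circuit:
  fixes \<alpha> :: "'n::finite \<Rightarrow>\<^sub>0 nat"
  assumes "even m" "m > 0" "weight \<alpha> = m" and d: "d \<in> dominating m c \<alpha>"
  shows "is_sos ((\<Sum>i\<in>UNIV. Poly_Mapping.single (Poly_Mapping.single i m) (d $ i)) + Poly_Mapping.single \<alpha> c)"
proof (cases "c = 0")
  case True
  then show ?thesis
    using d assms(1) by (simp add: is_sos_diagonal dominating_def)
next
  case False
  let ?a = "Poly_Mapping.lookup \<alpha>"
  define t where "t i = (if ?a i = 0 then 1 else root m (d $ i / ?a i))" for i
  \<comment> \<open>Zero off the support removes the diagonal entries there, while the monomial is
    unaffected because \<open>0 ^ 0 = 1\<close>.\<close>
  define x where "x i = (if ?a i = 0 then 0 else 1 / t i)" for i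
  have t_pos: "0 < t i" for i
    using dominating_support_pos[OF d False assms(2)] assms(2) by (simp add: t_def)
  have t_pow: "?a i * t i ^ m = d $ i" if "?a i > 0" for i
    using that dominating_support_pos[OF d False assms(2) that] assms(2) by (simp add: t_def)
  have t_le: "?a i * t i ^ m \<le> d $ i" for i
    using t_pow[of i] d by (cases "?a i = 0") (auto simp: dominating_def)
  have "monom_val (\<lambda>i. x i * t i) \<alpha> = 1"
    unfolding monom_val_def
    by (intro prod.neutral ballI) (use t_pos in \<open>simp add: x_def less_imp_neq[symmetric]\<close>)
  then have x_val: "monom_val x \<alpha> = 1 / monom_val t \<alpha>"
    using monom_val_pos[of t \<alpha>] t_pos by (simp add: monom_val_mult field_simps)
  have "\<bar>c\<bar> * monom_val x \<alpha> \<le> (\<Sum>i\<in>UNIV. d $ i * x i ^ m)"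
    using t_pos by (intro dominatingD[OF d]) (simp add: x_def less_imp_le)
  also have "\<dots> = (\<Sum>i\<in>UNIV. real (?a i))"
  proof (intro sum.cong refl)
    fix i
    show "d $ i * x i ^ m = real (?a i)"
      using t_pow[of i] t_pos[of i] assms(2) by (auto simp: x_def power_divide field_simps)
  qed
  also have "\<dots> = m"
    using assms(3) by (simp add: of_nat_sum[symmetric] del: of_nat_sum)
  finally have c_le: "\<bar>c\<bar> \<le> m * monom_val t \<alpha>"
    using monom_val_pos[of t \<alpha>] t_pos by (simp add: x_val field_simps)
  define k where "k = \<bar>c\<bar> / (m * monom_val t \<alpha>)"
  have mt: "0 < m * monom_val t \<alpha>"
    using monom_val_pos[of t \<alpha>] t_pos assms(2) by simp
  then have k: "0 \<le> k" "k \<le> 1"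
    using c_le by (simp_all add: k_def)
  have kc: "k * (sgn c * m * monom_val t \<alpha>) = c"
  proof -
    have "k * (m * monom_val t \<alpha>) = \<bar>c\<bar>"
      using nonzero_eq_divide_eq[OF less_imp_neq[OF mt, symmetric]] k_def by blast
    then have "sgn c * (k * (m * monom_val t \<alpha>)) = c"
      by (simp only: sgn_mult_abs)
    then show ?thesis
      by (simp only: mult.assoc mult.left_commute)
  qed
  have rest: "0 \<le> d $ i - k * (?a i * t i ^ m)" for i
    using mult_right_mono[OF k(2), of "?a i * t i ^ m"] t_pos[of i] t_le[of i] by simp
  let ?diag = "\<lambda>y :: 'n \<Rightarrow> real. \<Sum>i\<in>UNIV. Poly_Mapping.single (Poly_Mapping.single i m) (y i)"
  have "Poly_Mapping.single 0 k * agiform m t (sgn c) \<alpha> =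
      ?diag (\<lambda>i. k * (?a i * t i ^ m)) + Poly_Mapping.single \<alpha> c"
    by (simp only: agiform_def distrib_left sum_distrib_left mult_single kc add_0)
  moreover have "?diag (\<lambda>i. d $ i) =
      ?diag (\<lambda>i. d $ i - k * (?a i * t i ^ m)) + ?diag (\<lambda>i. k * (?a i * t i ^ m))"
    by (simp only: sum.distrib[symmetric] single_add[symmetric] diff_add_cancel)
  ultimately have "?diag (\<lambda>i. d $ i) + Poly_Mapping.single \<alpha> c =
      ?diag (\<lambda>i. d $ i - k * (?a i * t i ^ m)) + Poly_Mapping.single 0 k * agiform m t (sgn c) \<alpha>"
    by (simp only: add.assoc)
  moreover have "is_sos \<dots>"
    using False k(1) rest assms
    by (intro is_sos_add is_sos_diagonal is_sos_scale is_sos_agiform) (auto simp: sgn_if)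
  ultimately show ?thesis by simp
qed

text \<open>Sums of closed sets need not be closed. Here nonnegativity bounds each summand
  coordinatewise by the convergent sum, so a subsequence of the first summands converges, and with
  it that of the second.\<close>

lemma closed_set_plus_nonneg:
  fixes S T :: "(real ^ 'n) set"
  assumes "closed S" "closed T"
    and S: "\<And>s i. s \<in> S \<Longrightarrow> 0 \<le> s $ i" and T: "\<And>t i. t \<in> T \<Longrightarrow> 0 \<le> t $ i"
  shows "closed (S + T)"
  unfolding closed_sequential_limits
proof (intro allI impI, elim conjE)
  fix x l
  assume "\<forall>n. x n \<in> S + T" and lim: "x \<longlonglongrightarrow> l"
  then have "\<forall>n. \<exists>s t. s \<in> S \<and> t \<in> T \<and> x n = s + t"
    by (metis set_plus_elim)
  then obtain s t where st: "\<And>n. s n \<in> S" "\<And>n. t n \<in> T" "\<And>n. x n = s n + t n"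
    by metis
  obtain B where B: "\<And>n. norm (x n) \<le> B"
    using convergent_imp_bounded[OF lim] by (auto simp: bounded_iff)
  have "norm (s n) \<le> real CARD('n) * B" for n
  proof -
    have "norm (s n) \<le> (\<Sum>i\<in>UNIV. \<bar>s n $ i\<bar>)"
      by (rule norm_le_l1_cart)
    also have "\<dots> \<le> (\<Sum>i\<in>(UNIV :: 'n set). B)"
    proof (rule sum_mono)
      fix i
      have "\<bar>s n $ i\<bar> \<le> \<bar>x n $ i\<bar>"
        using S[OF st(1)] T[OF st(2)] st(3)[of n] by simp
      also have "\<dots> \<le> norm (x n)"
        by (rule component_le_norm_cart)
      finally show "\<bar>s n $ i\<bar> \<le> B"
        using B[of n] by simp
    qed
    finally show ?thesis by simp
  qed
  then have "bounded (range s)"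
    by (auto simp: bounded_iff)
  then obtain a r where r: "strict_mono (r :: nat \<Rightarrow> nat)" "(s \<circ> r) \<longlonglongrightarrow> a"
    using bounded_imp_convergent_subsequence by blast
  then have "a \<in> S"
    using assms(1) st(1) unfolding closed_sequential_limits by (metis comp_apply)
  have "(\<lambda>n. (x \<circ> r) n - (s \<circ> r) n) \<longlonglongrightarrow> l - a"
    by (rule tendsto_diff[OF LIMSEQ_subseq_LIMSEQ[OF lim r(1)] r(2)])
  then have "(t \<circ> r) \<longlonglongrightarrow> l - a"
    by (simp add: st(3) o_def)
  then have "l - a \<in> T"
    using assms(2) st(2) unfolding closed_sequential_limits by (metis comp_apply)
  then show "l \<in> S + T"
    using \<open>a \<in> S\<close> by (metis add_diff_cancel_left' set_plus_intro add.commute diff_add_cancel)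
qed

text \<open>The sum of sets is the Minkowski sum, with empty sum \<open>{0}\<close>.\<close>

lemma sum_dominating_nonneg:
  assumes "d \<in> (\<Sum>\<alpha>\<in>\<Omega>. dominating m (c \<alpha>) \<alpha>)"
  shows "0 \<le> d $ i"
  using assms
proof (induction \<Omega> arbitrary: d rule: infinite_finite_induct)
  case (insert \<alpha> \<Omega>)
  then show ?case
    by (auto simp: dominating_nonneg elim!: set_plus_elim)
qed auto

lemma closed_sum_dominating: "closed (\<Sum>\<alpha>\<in>\<Omega>. dominating m (c \<alpha>) \<alpha>)"
  by (induction \<Omega> rule: infinite_finite_induct)
    (auto intro!: closed_set_plus_nonneg closed_dominating intro: dominating_nonneg sum_dominating_nonneg)

text \<open>If \<open>b\<close> could not be split among the monomials, a hyperplane with normal \<open>w \<ge> 0\<close> would separate it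
  from all splittable vectors. After a small shift \<open>v = w + \<delta>\<close> into the open orthant, the form is
  negative at the point with \<open>x\<^sub>i\<^sup>m = v\<^sub>i\<close>: there the tangent vectors attain equality.\<close>

theorem dominating_split:
  fixes b :: "real ^ 'n" and c :: "('n \<Rightarrow>\<^sub>0 nat) \<Rightarrow> real"
  assumes "finite \<Omega>" "m > 0" and wt: "\<And>\<alpha>. \<alpha> \<in> \<Omega> \<Longrightarrow> weight \<alpha> = m"
    and dom: "\<And>x. (\<And>i. 0 < x i) \<Longrightarrow> (\<Sum>\<alpha>\<in>\<Omega>. \<bar>c \<alpha>\<bar> * monom_val x \<alpha>) \<le> (\<Sum>i\<in>UNIV. b $ i * x i ^ m)"
  obtains d r where "\<And>\<alpha>. \<alpha> \<in> \<Omega> \<Longrightarrow> d \<alpha> \<in> dominating m (c \<alpha>) \<alpha>" "\<And>i. 0 \<le> r $ i" "b = r + (\<Sum>\<alpha>\<in>\<Omega>. d \<alpha>)"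
proof -
  \<comment> \<open>The slack orthant makes \<open>D\<close> upward closed, which forces the
    separating normal to be nonnegative.\<close>
  define O' where "O' = {r :: real ^ 'n. \<forall>i. 0 \<le> r $ i}"
  define D where "D = O' + (\<Sum>\<alpha>\<in>\<Omega>. dominating m (c \<alpha>) \<alpha>)"
  have O': "closed O'" "convex O'"
  proof -
    have "O' = (\<Inter>i. {r. 0 \<le> r $ i})"
      by (auto simp: O'_def)
    then show "closed O'"
      by (simp, intro closed_INT ballI closed_Collect_le continuous_intros)
    show "convex O'"
      by (rule convexI) (simp add: O'_def)
  qed
  have D: "closed D" "convex D"
  proof -
    show "closed D"
      unfolding D_def
      by (rule closed_set_plus_nonneg[OF O'(1) closed_sum_dominating _ sum_dominating_nonneg]) (simp_all add: O'_def)
    show "convex D"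
      unfolding D_def by (intro convex_set_plus O'(2) convex_set_sum convex_dominating)
  qed
  have D_iff: "d \<in> D \<longleftrightarrow> (\<exists>r e. (\<forall>i. 0 \<le> r $ i) \<and> (\<forall>\<alpha>\<in>\<Omega>. e \<alpha> \<in> dominating m (c \<alpha>) \<alpha>) \<and> d = r + (\<Sum>\<alpha>\<in>\<Omega>. e \<alpha>))" for d
    unfolding D_def set_plus_def set_sum_alt[OF assms(1)] O'_def by auto
  have "b \<in> D"
  proof (rule ccontr)
    assume "b \<notin> D"
    then obtain w g where w: "w \<bullet> b < g" "\<And>d. d \<in> D \<Longrightarrow> g < w \<bullet> d"
      using separating_hyperplane_closed_point[OF D(2,1)] by blast
    have e: "tangent m (c \<alpha>) \<alpha> x \<in> dominating m (c \<alpha>) \<alpha>" "(\<Sum>i\<in>UNIV. tangent m (c \<alpha>) \<alpha> x $ i * x i ^ m) = \<bar>c \<alpha>\<bar> * monom_val x \<alpha>"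
      if "\<alpha> \<in> \<Omega>" "\<And>i. 0 < x i" for x \<alpha>
      using tangent_in_dominating[of \<alpha> m x, OF wt[OF that(1)] assms(2)] that(2) by simp_all
    have eD: "r + (\<Sum>\<alpha>\<in>\<Omega>. tangent m (c \<alpha>) \<alpha> x) \<in> D" if "\<And>i. 0 < x i" "\<And>i. 0 \<le> r $ i" for x r
      unfolding D_iff using that(2) e(1)[OF _ that(1)]
      by (intro exI[of _ r] exI[of _ "\<lambda>\<alpha>. tangent m (c \<alpha>) \<alpha> x"]) simp
    have w_nonneg: "0 \<le> w $ i" for i
    proof (rule ccontr)
      assume neg: "\<not> 0 \<le> w $ i"
      define d where "d = (\<Sum>\<alpha>\<in>\<Omega>. tangent m (c \<alpha>) \<alpha> (\<lambda>_. 1))"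
      \<comment> \<open>Moving this far along axis \<open>i\<close> stays in \<open>D\<close> but
        pushes the inner product with \<open>w\<close> down to \<open>g\<close> or below.\<close>
      define u where "u = (\<bar>w \<bullet> d\<bar> + \<bar>g\<bar>) / - (w $ i)"
      have "0 \<le> u"
        using neg unfolding u_def by (intro divide_nonneg_pos) auto
      then have "u *\<^sub>R axis i 1 + d \<in> D"
        unfolding d_def by (intro eD) (auto simp: axis_def)
      then have "g < w \<bullet> (u *\<^sub>R axis i 1 + d)"
        by (rule w(2))
      then have "g < u * w $ i + w \<bullet> d"
        by (simp add: inner_add_right inner_axis)
      moreover have "u * w $ i = - (\<bar>w \<bullet> d\<bar> + \<bar>g\<bar>)"
        using neg by (simp add: u_def)
      ultimately show False by linarith
    qed
    \<comment> \<open>The shift may raise the value at \<open>b\<close> by at most the gap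
      \<open>g - w \<bullet> b\<close>; the added 1 keeps the denominator positive.\<close>
    define \<delta> where "\<delta> = (g - w \<bullet> b) / (1 + \<bar>\<Sum>i\<in>UNIV. b $ i\<bar>)"
    have "0 < \<delta>"
      using w(1) by (simp add: \<delta>_def)
    have "\<delta> * (\<Sum>i\<in>UNIV. b $ i) \<le> \<delta> * (1 + \<bar>\<Sum>i\<in>UNIV. b $ i\<bar>)"
      using \<open>0 < \<delta>\<close> by (intro mult_left_mono) auto
    also have "\<dots> = g - w \<bullet> b"
      by (simp add: \<delta>_def add_nonneg_eq_0_iff)
    finally have small: "\<delta> * (\<Sum>i\<in>UNIV. b $ i) \<le> g - w \<bullet> b" .
    define x where "x i = root m (w $ i + \<delta>)" for i
    have x: "0 < x i" "x i ^ m = w $ i + \<delta>" for i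
      using w_nonneg[of i] \<open>0 < \<delta>\<close> assms(2) by (simp_all add: x_def add_nonneg_pos)
    define d where "d = (\<Sum>\<alpha>\<in>\<Omega>. tangent m (c \<alpha>) \<alpha> x)"
    have val: "(\<Sum>i\<in>UNIV. y $ i * x i ^ m) = w \<bullet> y + \<delta> * (\<Sum>i\<in>UNIV. y $ i)" for y :: "real ^ 'n"
      by (simp add: x(2) inner_vec_def distrib_left sum.distrib sum_distrib_left mult.commute)
    have "d \<in> D"
      unfolding d_def using eD[of x 0] x(1) by simp
    then have "g < w \<bullet> d"
      by (rule w(2))
    moreover have "0 \<le> \<delta> * (\<Sum>i\<in>UNIV. d $ i)"
      using e(1) x(1) \<open>0 < \<delta>\<close> unfolding d_def sum_component
      by (intro mult_nonneg_nonneg sum_nonneg dominating_nonneg) auto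
    moreover have "(\<Sum>i\<in>UNIV. d $ i * x i ^ m) = (\<Sum>\<alpha>\<in>\<Omega>. \<bar>c \<alpha>\<bar> * monom_val x \<alpha>)"
      unfolding d_def sum_component sum_distrib_right
      by (subst sum.swap) (intro sum.cong refl e(2) x(1))
    \<comment> \<open>The value of the diagonal form at \<open>x\<close> is above \<open>g\<close>
      for \<open>d\<close> and at most \<open>g\<close> for \<open>b\<close>, yet \<open>dom\<close>
      bounds the former by the latter.\<close>
    ultimately show False
      using dom[of x, OF x(1)] val[of d] val[of b] small by linarith
  qed
  then show ?thesis
    using that unfolding D_iff by blast
qed

text \<open>Each term, paired with its share of the split diagonal, falls under
  \<open>is_sos_circuit\<close>; the leftover \<open>r\<close> is a nonnegative diagonal.\<close>

theorem is_sos_of_abs_dominated: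
  fixes b :: "real ^ 'n" and c :: "('n \<Rightarrow>\<^sub>0 nat) \<Rightarrow> real"
  assumes "finite \<Omega>" "even m" "m > 0" and wt: "\<And>\<alpha>. \<alpha> \<in> \<Omega> \<Longrightarrow> weight \<alpha> = m"
    and dom: "\<And>x. (\<And>i. 0 < x i) \<Longrightarrow> (\<Sum>\<alpha>\<in>\<Omega>. \<bar>c \<alpha>\<bar> * monom_val x \<alpha>) \<le> (\<Sum>i\<in>UNIV. b $ i * x i ^ m)"
  shows "is_sos ((\<Sum>i\<in>UNIV. Poly_Mapping.single (Poly_Mapping.single i m) (b $ i)) + (\<Sum>\<alpha>\<in>\<Omega>. Poly_Mapping.single \<alpha> (c \<alpha>)))"
proof -
  obtain d r where dr: "\<And>\<alpha>. \<alpha> \<in> \<Omega> \<Longrightarrow> d \<alpha> \<in> dominating m (c \<alpha>) \<alpha>" "\<And>i. 0 \<le> r $ i"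
    "b = r + (\<Sum>\<alpha>\<in>\<Omega>. d \<alpha>)"
    using dominating_split[OF assms(1,3) wt dom] by metis
  let ?diag = "\<lambda>y :: real ^ 'n. \<Sum>i\<in>UNIV. Poly_Mapping.single (Poly_Mapping.single i m) (y $ i)"
  have add: "?diag (y + z) = ?diag y + ?diag z" for y z
    by (simp add: single_add sum.distrib)
  have "?diag (\<Sum>\<alpha>\<in>\<Omega>. d \<alpha>) = (\<Sum>\<alpha>\<in>\<Omega>. ?diag (d \<alpha>))"
    using assms(1) by (induction \<Omega> rule: finite_induct) (simp_all add: single_add sum.distrib)
  then have "?diag b + (\<Sum>\<alpha>\<in>\<Omega>. Poly_Mapping.single \<alpha> (c \<alpha>)) =
      ?diag r + (\<Sum>\<alpha>\<in>\<Omega>. ?diag (d \<alpha>) + Poly_Mapping.single \<alpha> (c \<alpha>))"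
    unfolding dr(3) add by (simp add: sum.distrib add.assoc)
  moreover have "is_sos \<dots>"
    using dr assms by (intro is_sos_add is_sos_diagonal is_sos_sum is_sos_circuit) auto
  ultimately show ?thesis by simp
qed

section \<open>Extended Z-polynomials\<close>

lemma mixed_indices_weight: "\<alpha> \<in> mixed_indices m G \<Longrightarrow> weight \<alpha> = m"
  by (simp add: mixed_indices_def)

lemma mixed_indices_keys: "\<alpha> \<in> mixed_indices m G \<Longrightarrow> Poly_Mapping.keys \<alpha> \<subseteq> G"
  by (simp add: mixed_indices_def)

text \<open>Mixed monomials vanish at unit vectors, so evaluation there reads off a diagonal
  coefficient.\<close>

lemma monom_val_indicator_mixed:
  assumes "\<alpha> \<in> mixed_indices m G"
  shows "monom_val (\<lambda>j. if j = i then 1 else 0) \<alpha> = 0"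
proof (rule ccontr)
  assume nz: "monom_val (\<lambda>j. if j = i then 1 else 0) \<alpha> \<noteq> 0"
  have "Poly_Mapping.lookup \<alpha> j = 0" if "j \<noteq> i" for j
    using nz that by (auto simp: monom_val_def split: if_splits)
  then have "\<alpha> = Poly_Mapping.single i (Poly_Mapping.lookup \<alpha> i)"
    by (intro poly_mapping_eqI) (auto simp: lookup_single when_def)
  moreover from arg_cong[OF this, of "\<lambda>a. weight a"] have "Poly_Mapping.lookup \<alpha> i = m"
    using mixed_indices_weight[OF assms] by (simp only: weight_single)
  ultimately have "\<alpha> = Poly_Mapping.single i m"
    by (simp only:)
  then show False
    using assms unfolding mixed_indices_def by blast
qed

lemma monom_val_flip:
  "monom_val (x(i := - x i)) \<alpha> = (-1) ^ Poly_Mapping.lookup \<alpha> i * monom_val x \<alpha>"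
proof -
  have "x(i := - x i) = (\<lambda>j. (if j = i then - 1 else 1) * x j)"
    by auto
  moreover have "monom_val (\<lambda>j. if j = i then - 1 else 1) \<alpha> =
      (\<Prod>j\<in>UNIV. if j = i then (- 1) ^ Poly_Mapping.lookup \<alpha> j else 1)"
    unfolding monom_val_def by (intro prod.cong) auto
  ultimately show ?thesis
    by (simp add: monom_val_mult)
qed

lemma even_multiindex:
  assumes "\<And>i. even (Poly_Mapping.lookup \<beta> i)"
  obtains \<gamma> :: "'a \<Rightarrow>\<^sub>0 nat" where "\<beta> = \<gamma> + \<gamma>"
proof
  show "\<beta> = Poly_Mapping.map (\<lambda>k. k div 2) \<beta> + Poly_Mapping.map (\<lambda>k. k div 2) \<beta>"
  proof (rule poly_mapping_eqI)
    fix i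
    show "Poly_Mapping.lookup \<beta> i =
        Poly_Mapping.lookup (Poly_Mapping.map (\<lambda>k. k div 2) \<beta> + Poly_Mapping.map (\<lambda>k. k div 2) \<beta>) i"
      using assms[of i] by (auto simp: lookup_add map.rep_eq when_def)
  qed
qed

lemma is_sos_block:
  fixes b :: "real ^ 'n" and c :: "('n \<Rightarrow>\<^sub>0 nat) \<Rightarrow> real"
  assumes "even m" "m > 0"
    and psd: "\<And>x. 0 \<le> (\<Sum>i\<in>UNIV. b $ i * x i ^ m) + (\<Sum>\<alpha>\<in>mixed_indices m G. c \<alpha> * monom_val x \<alpha>)"
    and signs: "(\<exists>\<beta>\<in>mixed_indices m G. \<forall>\<alpha>\<in>mixed_indices m G - {\<beta>}. c \<alpha> = 0) \<or>
      (\<forall>\<alpha>\<in>mixed_indices m G. c \<alpha> \<le> 0)"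
  shows "is_sos ((\<Sum>i\<in>UNIV. Poly_Mapping.single (Poly_Mapping.single i m) (b $ i)) +
      (\<Sum>\<alpha>\<in>mixed_indices m G. Poly_Mapping.single \<alpha> (c \<alpha>)))"
proof (cases "\<forall>\<alpha>\<in>mixed_indices m G. c \<alpha> \<le> 0")
  case True
  show ?thesis
  proof (rule is_sos_of_abs_dominated[OF finite_mixed_indices assms(1,2) mixed_indices_weight])
    fix x :: "'n \<Rightarrow> real"
    have "(\<Sum>\<alpha>\<in>mixed_indices m G. \<bar>c \<alpha>\<bar> * monom_val x \<alpha>) = - (\<Sum>\<alpha>\<in>mixed_indices m G. c \<alpha> * monom_val x \<alpha>)"
      unfolding sum_negf[symmetric] using True by (intro sum.cong) auto
    then show "(\<Sum>\<alpha>\<in>mixed_indices m G. \<bar>c \<alpha>\<bar> * monom_val x \<alpha>) \<le> (\<Sum>i\<in>UNIV. b $ i * x i ^ m)"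
      using psd[of x] by simp
  qed
next
  case False
  then obtain \<beta> where \<beta>: "\<beta> \<in> mixed_indices m G" "\<And>\<alpha>. \<alpha> \<in> mixed_indices m G \<Longrightarrow> \<alpha> \<noteq> \<beta> \<Longrightarrow> c \<alpha> = 0"
    using signs by blast
  have c_pos: "0 < c \<beta>"
    using False \<beta> by (metis less_eq_real_def not_less)
  \<comment> \<open>Kept generic in the target monoid, as it serves both real values and
    polynomials.\<close>
  have only_\<beta>: "(\<Sum>\<alpha>\<in>mixed_indices m G. h \<alpha>) = h \<beta>"
    if "\<And>\<alpha>. c \<alpha> = 0 \<Longrightarrow> h \<alpha> = 0" for h :: "('n \<Rightarrow>\<^sub>0 nat) \<Rightarrow> 'b::comm_monoid_add"
    using \<beta> that by (subst sum.remove[OF finite_mixed_indices \<beta>(1)]) (simp add: sum.neutral)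
  show ?thesis
  proof (cases "\<exists>i. odd (Poly_Mapping.lookup \<beta> i)")
    case True
    then obtain i where i: "odd (Poly_Mapping.lookup \<beta> i)"
      by blast
    show ?thesis
    proof (rule is_sos_of_abs_dominated[OF finite_mixed_indices assms(1,2) mixed_indices_weight])
      fix x :: "'n \<Rightarrow> real"
      \<comment> \<open>The flip preserves the diagonal, \<open>m\<close> being even, and negates
        the monomial of \<beta>, whose exponent at \<open>i\<close> is odd.\<close>
      let ?y = "x(i := - x i)"
      have "(\<Sum>j\<in>UNIV. b $ j * ?y j ^ m) = (\<Sum>j\<in>UNIV. b $ j * x j ^ m)"
        using assms(1) by (intro sum.cong) auto
      then have "0 \<le> (\<Sum>j\<in>UNIV. b $ j * x j ^ m) + c \<beta> * monom_val ?y \<beta>"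
        using psd[of ?y] only_\<beta>[of "\<lambda>\<alpha>. c \<alpha> * monom_val ?y \<alpha>"] by simp
      then show "(\<Sum>\<alpha>\<in>mixed_indices m G. \<bar>c \<alpha>\<bar> * monom_val x \<alpha>) \<le> (\<Sum>i\<in>UNIV. b $ i * x i ^ m)"
        using i c_pos by (subst only_\<beta>) (simp_all add: monom_val_flip)
    qed
  next
    case False
    then have "even (Poly_Mapping.lookup \<beta> i)" for i
      by blast
    then obtain \<gamma> where \<gamma>: "\<beta> = \<gamma> + \<gamma>"
      by (rule even_multiindex)
    have "0 \<le> b $ i" for i
    proof -
      let ?x = "\<lambda>j. if j = i then 1 else 0 :: real"
      have "(\<Sum>j\<in>UNIV. b $ j * ?x j ^ m) = (\<Sum>j\<in>UNIV. if j = i then b $ j else 0)"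
        using assms(2) by (intro sum.cong) auto
      then show ?thesis
        using psd[of ?x] by (simp add: monom_val_indicator_mixed)
    qed
    then have "is_sos (\<Sum>i\<in>UNIV. Poly_Mapping.single (Poly_Mapping.single i m) (b $ i))"
      by (rule is_sos_diagonal[OF assms(1)])
    moreover have "is_sos (\<Sum>\<alpha>\<in>mixed_indices m G. Poly_Mapping.single \<alpha> (c \<alpha>))"
      using c_pos by (subst only_\<beta>) (simp_all add: \<gamma> is_sos_single_double)
    ultimately show ?thesis
      by (rule is_sos_add)
  qed
qed

theorem is_sos_extended_Z_polynomial:
  fixes f :: "'n::finite real_mpoly"
  assumes "even m" and psd: "\<And>x. 0 \<le> mpoly_eval f x" and "extended_Z_polynomial m f"
  shows "is_sos f"
proof -
  define c where "c = Poly_Mapping.lookup f"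
  obtain s and \<Gamma> :: "nat \<Rightarrow> 'n set" where
    cover: "(\<Union>l\<in>{1..s}. \<Gamma> l) = UNIV" and
    "\<forall>l1\<in>{1..s}. \<forall>l2\<in>{1..s}. l1 \<noteq> l2 \<longrightarrow> \<Gamma> l1 \<inter> \<Gamma> l2 = {}" and
    f: "f = (\<Sum>i\<in>UNIV. Poly_Mapping.single (Poly_Mapping.single i m) (c (Poly_Mapping.single i m)))
          + (\<Sum>l=1..s. \<Sum>\<alpha>\<in>mixed_indices m (\<Gamma> l). Poly_Mapping.single \<alpha> (c \<alpha>))" and
    "\<forall>l\<in>{1..s}.
      (\<exists>\<beta>\<in>mixed_indices m (\<Gamma> l). \<forall>\<alpha>\<in>mixed_indices m (\<Gamma> l) - {\<beta>}. c \<alpha> = 0) \<or>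
      (\<forall>\<alpha>\<in>mixed_indices m (\<Gamma> l). c \<alpha> \<le> 0)"
    using assms(3) unfolding extended_Z_polynomial_def c_def[symmetric] by (elim exE conjE) (rule that)
  then have disj: "\<And>l1 l2. l1 \<in> {1..s} \<Longrightarrow> l2 \<in> {1..s} \<Longrightarrow> l1 \<noteq> l2 \<Longrightarrow> \<Gamma> l1 \<inter> \<Gamma> l2 = {}"
    and signs: "\<And>l. l \<in> {1..s} \<Longrightarrow>
      (\<exists>\<beta>\<in>mixed_indices m (\<Gamma> l). \<forall>\<alpha>\<in>mixed_indices m (\<Gamma> l) - {\<beta>}. c \<alpha> = 0) \<or>
      (\<forall>\<alpha>\<in>mixed_indices m (\<Gamma> l). c \<alpha> \<le> 0)"
    by simp_all
  have eval: "mpoly_eval f (\<chi> i. x i) = (\<Sum>i\<in>UNIV. c (Poly_Mapping.single i m) * x i ^ m) +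
      (\<Sum>l=1..s. \<Sum>\<alpha>\<in>mixed_indices m (\<Gamma> l). c \<alpha> * monom_val x \<alpha>)" for x
  proof -
    have single: "mpoly_eval (Poly_Mapping.single \<alpha> k) (\<chi> i. x i) = k * monom_val x \<alpha>" for \<alpha> k
      by (simp add: mpoly_eval_single monom_val_def)
    show ?thesis
      using arg_cong[OF f, of "\<lambda>g. mpoly_eval g (\<chi> i. x i)"]
      by (simp only: mpoly_eval_add mpoly_eval_sum single monom_val_single)
  qed
  show ?thesis
  proof (cases "m = 0")
    case True
    \<comment> \<open>In order 0 every pure power has multi-index 0, so the form is the constant
      \<open>CARD('n) * c 0\<close>.\<close>
    then have no_mixed: "mixed_indices m G = {}" for G :: "'n set"
      by (auto simp: mixed_indices_def intro: poly_mapping_eqI)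
    have "0 \<le> real CARD('n) * c 0"
      using psd[of "\<chi> i. 0"] eval[of "\<lambda>_. 0"] no_mixed True by simp
    then have "0 \<le> c 0"
      by (simp add: zero_le_mult_iff)
    then have "is_sos (\<Sum>i\<in>(UNIV :: 'n set). Poly_Mapping.single (Poly_Mapping.single i m) (c (Poly_Mapping.single i m)))"
      by (intro is_sos_diagonal[OF assms(1)]) (simp add: True)
    then show ?thesis
      by (subst f) (simp add: no_mixed)
  next
    case False
    then have "m > 0" by simp
    \<comment> \<open>The diagonal is cut along the blocks; since these partition the variables, the
      pieces add up to the whole.\<close>
    define b where "b l = (\<chi> i. if i \<in> \<Gamma> l then c (Poly_Mapping.single i m) else 0)" for l
    have "is_sos ((\<Sum>i\<in>UNIV. Poly_Mapping.single (Poly_Mapping.single i m) (b l $ i)) +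
        (\<Sum>\<alpha>\<in>mixed_indices m (\<Gamma> l). Poly_Mapping.single \<alpha> (c \<alpha>)))" if l: "l \<in> {1..s}" for l
    proof (rule is_sos_block[OF assms(1) \<open>m > 0\<close> _ signs[OF l]])
      fix x :: "'n \<Rightarrow> real"
      define y where "y i = (if i \<in> \<Gamma> l then x i else 0)" for i
      have restrict: "(\<Sum>\<alpha>\<in>mixed_indices m (\<Gamma> k). c \<alpha> * monom_val y \<alpha>) =
          (if k = l then \<Sum>\<alpha>\<in>mixed_indices m (\<Gamma> l). c \<alpha> * monom_val x \<alpha> else 0)" if k: "k \<in> {1..s}" for k
      proof (cases "k = l")
        case True
        have "monom_val y \<alpha> = monom_val x \<alpha>" if "\<alpha> \<in> mixed_indices m (\<Gamma> l)" for \<alpha>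
          unfolding monom_val_def
        proof (intro prod.cong refl)
          fix i
          show "y i ^ Poly_Mapping.lookup \<alpha> i = x i ^ Poly_Mapping.lookup \<alpha> i"
            using mixed_indices_keys[OF that]
            by (cases "i \<in> Poly_Mapping.keys \<alpha>") (auto simp: y_def not_in_keys_iff_lookup_eq_zero)
        qed
        then show ?thesis
          using True by simp
      next
        case False
        have "monom_val y \<alpha> = 0" if \<alpha>: "\<alpha> \<in> mixed_indices m (\<Gamma> k)" for \<alpha>
        proof -
          \<comment> \<open>Positive weight yields an index in the support; it lies in
            \<open>\<Gamma> k\<close>, hence outside \<open>\<Gamma> l\<close>, where
            \<open>y\<close> is 0.\<close>
          have "\<alpha> \<noteq> 0"
            using mixed_indices_weight[OF \<alpha>] \<open>m > 0\<close> by auto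
          then obtain i where i: "i \<in> Poly_Mapping.keys \<alpha>"
            by (meson ex_in_conv keys_eq_empty)
          then have "i \<in> \<Gamma> k"
            using mixed_indices_keys[OF \<alpha>] by blast
          then have "y i ^ Poly_Mapping.lookup \<alpha> i = 0"
            using disj[OF k l False] i by (auto simp: y_def in_keys_iff)
          then show ?thesis
            unfolding monom_val_def by (meson UNIV_I finite prod_zero)
        qed
        then show ?thesis
          using False by simp
      qed
      have "(\<Sum>k=1..s. \<Sum>\<alpha>\<in>mixed_indices m (\<Gamma> k). c \<alpha> * monom_val y \<alpha>) =
          (\<Sum>\<alpha>\<in>mixed_indices m (\<Gamma> l). c \<alpha> * monom_val x \<alpha>)"
        using l by (subst sum.cong[OF refl restrict]) simp_all
      moreover have "(\<Sum>i\<in>UNIV. c (Poly_Mapping.single i m) * y i ^ m) = (\<Sum>i\<in>UNIV. b l $ i * x i ^ m)"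
        using \<open>m > 0\<close> by (intro sum.cong) (auto simp: y_def b_def)
      ultimately show "0 \<le> (\<Sum>i\<in>UNIV. b l $ i * x i ^ m) + (\<Sum>\<alpha>\<in>mixed_indices m (\<Gamma> l). c \<alpha> * monom_val x \<alpha>)"
        using psd[of "\<chi> i. y i"] eval[of y] by simp
    qed
    then have "is_sos (\<Sum>l=1..s. (\<Sum>i\<in>UNIV. Poly_Mapping.single (Poly_Mapping.single i m) (b l $ i)) +
        (\<Sum>\<alpha>\<in>mixed_indices m (\<Gamma> l). Poly_Mapping.single \<alpha> (c \<alpha>)))"
      by (rule is_sos_sum)
    moreover have "(\<Sum>l=1..s. \<Sum>i\<in>UNIV. Poly_Mapping.single (Poly_Mapping.single i m) (b l $ i)) =
        (\<Sum>i\<in>UNIV. Poly_Mapping.single (Poly_Mapping.single i m) (c (Poly_Mapping.single i m)))"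
    proof (subst sum.swap, intro sum.cong refl)
      fix i :: 'n
      obtain l where l: "l \<in> {1..s}" "i \<in> \<Gamma> l"
        using cover by blast
      have only_l: "Poly_Mapping.single (Poly_Mapping.single i m) (b k $ i) =
          (if k = l then Poly_Mapping.single (Poly_Mapping.single i m) (c (Poly_Mapping.single i m)) else 0)"
        if "k \<in> {1..s}" for k
        using disj[OF that l(1)] l(2) by (auto simp: b_def)
      show "(\<Sum>k=1..s. Poly_Mapping.single (Poly_Mapping.single i m) (b k $ i)) =
          Poly_Mapping.single (Poly_Mapping.single i m) (c (Poly_Mapping.single i m))"
        using l(1) by (subst sum.cong[OF refl only_l]) simp_all
    qed
    ultimately show ?thesis
      by (subst f) (simp add: sum.distrib)
  qed
qed

theorem theorem3p4:
  fixes m :: nat and A :: "'n::finite tensor"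
  assumes "even m"
    and "symmetric_tensor m A"
    and "psd_tensor m A"
    and "extended_Z_tensor m A"
  shows "sos_tensor_decomposition m A"
  using is_sos_extended_Z_polynomial[of m "tensor_form m A"] assms
  by (simp add: psd_tensor_def extended_Z_tensor_def sos_tensor_decomposition_def is_sos_def)

end
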